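(* Let $\mathcal P\subset\mathbb R^n$ be an $n$-dimensional convex polytope and consider $\dot x=Ax+a+Bu$, $x\in\mathcal P$, with $\operatorname{rank}(B)=n-1$, $(A,B)$ controllable and $\operatorname{int}\mathcal P\cap\mathcal O=\emptyset$. Let $y,z$ be distinct points of $\mathcal P$ and let $l$ be the line segment joining them. If $z,y\in\mathcal O$ and $y\in\mathcal B_z$, then $z\xrightarrow{l}y$.
   Context: $\mathcal B=\operatorname{Im}(B)$, $\mathcal O=\{x:Ax+a\in\mathcal B\}$; $\beta$ is the unit normal to $\mathcal B$ with $\beta^T(Ax+a)\le0$ on $\mathcal P$; $\mathcal B_z=\{x\in\mathbb R^n:\beta^Tx=\beta^Tz\}$. $z\xrightarrow{l}y$ means there exist a piecewise continuous control $u$ and $T\ge0$ such that the solution $\phi^u_t(z)$ satisfies $\phi^u_T(z)=y$ and $\phi^u_t(z)\in l$ for all $t\in[0,T]$. *)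

theory Defs
  imports "HOL-Analysis.Analysis"
begin

text \<open>Kalman controllability of the pair (A,B):
  rank [B, AB, ..., A^(n-1) B] = n, i.e. the columns of all A^k B (k < n) span R^n.\<close>
definition controllable :: "real^'n^'n \<Rightarrow> real^'m^'n \<Rightarrow> bool" where
  "controllable A B \<longleftrightarrow>
     span (\<Union>k\<in>{..<CARD('n)}. range (\<lambda>v. (((*v) A) ^^ k) (B *v v))) = UNIV"

text \<open>Piecewise continuity on [a,b]: continuous except at finitely many points,
  at each of which the one-sided limits (within [a,b]) exist.\<close>
definition piecewise_continuous_on :: "real \<Rightarrow> real \<Rightarrow> (real \<Rightarrow> 'b::topological_space) \<Rightarrow> bool" where
  "piecewise_continuous_on a b u \<longleftrightarrow>
     (\<exists>S. finite S \<and>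
        (\<forall>t\<in>{a..b} - S. continuous (at t within {a..b}) u) \<and>
        (\<forall>s\<in>S \<inter> {a..b}.
           (s > a \<longrightarrow> (\<exists>L. (u \<longlongrightarrow> L) (at_left s))) \<and>
           (s < b \<longrightarrow> (\<exists>R. (u \<longlongrightarrow> R) (at_right s)))))"

text \<open>O = {x. Ax + a \<in> Im B}.\<close>
definition obs_set :: "real^'n^'n \<Rightarrow> real^'n \<Rightarrow> real^'m^'n \<Rightarrow> (real^'n) set" where
  "obs_set A a B = {x. A *v x + a \<in> range ((*v) B)}"

text \<open>B_z = {x. beta^T x = beta^T z}.\<close>
definition Bz :: "real^'n \<Rightarrow> real^'n \<Rightarrow> (real^'n) set" where
  "Bz \<beta> z = {x. \<beta> \<bullet> x = \<beta> \<bullet> z}"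

text \<open>z --l--> y: there are a piecewise continuous control u and T \<ge> 0 such that the
  (Caratheodory) solution phi of x' = Ax + a + Bu, phi(0) = z, satisfies phi(T) = y and
  stays in l on [0,T].\<close>
definition reach_within ::
  "real^'n^'n \<Rightarrow> real^'n \<Rightarrow> real^'m^'n \<Rightarrow> (real^'n) set \<Rightarrow> real^'n \<Rightarrow> real^'n \<Rightarrow> bool" where
  "reach_within A a B l z y \<longleftrightarrow>
     (\<exists>(u::real \<Rightarrow> real^'m) (T::real) (\<phi>::real \<Rightarrow> real^'n).
        T \<ge> 0 \<and> piecewise_continuous_on 0 T u \<and>
        continuous_on {0..T} \<phi> \<and> \<phi> 0 = z \<and>
        (\<forall>t\<in>{0..T}. ((\<lambda>s. A *v \<phi> s + a + B *v u s) has_integral (\<phi> t - z)) {0..t}) \<and>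
        \<phi> T = y \<and> (\<forall>t\<in>{0..T}. \<phi> t \<in> l))"

end

theory Submission
  imports Defs
begin

text \<open>Along the segment from z to y the drift Ax + a is the convex combination of its values at
  the endpoints, which lie in Im B, and the velocity y - z lies in Im B because Im B is exactly
  the hyperplane orthogonal to \<beta>. So a continuous control cancels the drift and moves the state
  along the segment at constant velocity.\<close>

lemma range_matrix_eq_hyperplane:
  fixes B :: "real^'m^'n" and \<beta> :: "real^'n"
  assumes "rank B = CARD('n) - 1" and "\<beta> \<noteq> 0" and "\<forall>v. \<beta> \<bullet> (B *v v) = 0"
  shows "range ((*v) B) = {x. \<beta> \<bullet> x = 0}"
proof (rule subspace_dim_equal)
  show "subspace (range ((*v) B))"
    by (simp add: linear_subspace_image matrix_vector_mul_linear)
  show "subspace {x. \<beta> \<bullet> x = 0}" by (rule subspace_hyperplane)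
  show "range ((*v) B) \<subseteq> {x. \<beta> \<bullet> x = 0}" using assms(3) by auto
  show "dim {x. \<beta> \<bullet> x = 0} \<le> dim (range ((*v) B))"
    using assms(1) rank_dim_range[of B] dim_hyperplane[OF assms(2)] by simp
qed

lemma piecewise_continuous_on_if_continuous_on:
  assumes "continuous_on {a..b} u"
  shows "piecewise_continuous_on a b u"
  unfolding piecewise_continuous_on_def
  using assms by (intro exI[of _ "{}"]) (auto simp: continuous_on_eq_continuous_within)

lemma reach_within_closed_segment:
  fixes A :: "real^'n^'n" and a :: "real^'n" and B :: "real^'m^'n"
  assumes "z \<in> obs_set A a B" and "y \<in> obs_set A a B" and "y - z \<in> range ((*v) B)"
  shows "reach_within A a B (closed_segment z y) z y"
proof -
  obtain wz where wz: "A *v z + a = B *v wz" using assms(1) unfolding obs_set_def by auto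
  obtain wy where wy: "A *v y + a = B *v wy" using assms(2) unfolding obs_set_def by auto
  obtain v where v: "y - z = B *v v" using assms(3) by auto
  define \<phi> where "\<phi> = (\<lambda>t::real. z + t *\<^sub>R (y - z))"
  define u where "u = (\<lambda>t::real. v - ((1 - t) *\<^sub>R wz + t *\<^sub>R wy))"
  have constant_velocity: "A *v \<phi> s + a + B *v u s = y - z" for s
  proof -
    have "A *v \<phi> s + a = (1 - s) *\<^sub>R (A *v z + a) + s *\<^sub>R (A *v y + a)"
      unfolding \<phi>_def by (simp add: algebra_simps)
    also have "\<dots> = B *v ((1 - s) *\<^sub>R wz + s *\<^sub>R wy)"
      by (simp add: wz[symmetric] wy[symmetric] algebra_simps)
    finally show ?thesis
      unfolding u_def by (simp add: v matrix_vector_mult_diff_distrib)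
  qed
  show ?thesis
    unfolding reach_within_def
  proof (intro exI conjI ballI)
    show "piecewise_continuous_on 0 1 u"
      unfolding u_def by (intro piecewise_continuous_on_if_continuous_on continuous_intros)
    show "continuous_on {0..1} \<phi>" unfolding \<phi>_def by (intro continuous_intros)
    fix t :: real assume t: "t \<in> {0..1}"
    show "((\<lambda>s. A *v \<phi> s + a + B *v u s) has_integral (\<phi> t - z)) {0..t}"
      unfolding constant_velocity using has_integral_const_real[of "y - z" 0 t] t
      by (simp add: \<phi>_def)
    show "\<phi> t \<in> closed_segment z y"
      unfolding \<phi>_def closed_segment_def using t
      by (intro CollectI exI[of _ t]) (auto simp: algebra_simps)
  qed (simp_all add: \<phi>_def)
qed

theorem lemma3:
  fixes A :: "real^'n^'n" and a :: "real^'n" and B :: "real^'m^'n"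
    and P :: "(real^'n) set" and \<beta> y z :: "real^'n"
  assumes "polytope P" and "aff_dim P = int CARD('n)"
    and "rank B = CARD('n) - 1"
    and "controllable A B"
    and "interior P \<inter> obs_set A a B = {}"
    and "norm \<beta> = 1" and "\<forall>v. \<beta> \<bullet> (B *v v) = 0"
    and "\<forall>x\<in>P. \<beta> \<bullet> (A *v x + a) \<le> 0"
    and "y \<in> P" and "z \<in> P" and "y \<noteq> z"
    and "z \<in> obs_set A a B" and "y \<in> obs_set A a B"
    and "y \<in> Bz \<beta> z"
  shows "reach_within A a B (closed_segment z y) z y"
proof (rule reach_within_closed_segment[OF assms(12,13)])
  have "\<beta> \<noteq> 0" using assms(6) by auto
  moreover have "\<beta> \<bullet> (y - z) = 0"
    using assms(14) unfolding Bz_def by (simp add: inner_diff_right)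
  ultimately show "y - z \<in> range ((*v) B)"
    using range_matrix_eq_hyperplane[OF assms(3) _ assms(7)] by blast
qed

end
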